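(* Assume that $|\gamma_l(m)|<1$ for all $1\le m\le M$ and $1\le l\le d$. Let $\Phi=\{\phi_1,\ldots,\phi_r\}$ be a family of nonzero graph signals, let $\tilde\Phi=\{\tilde\phi_1,\ldots,\tilde\phi_r\}\subset\mathcal{S}(\Phi)$, and set $$\mathbf{B}(m)=\big[\langle\widehat{\phi}_i(m),\widehat{\tilde\phi}_j(m)\rangle\big]_{1\le i,j\le r},\quad 1\le m\le M.$$ Then $\tilde\Phi$ generates a shift-invariant dual frame if and only if $\mathcal{S}(\tilde\Phi)=\mathcal{S}(\Phi)$ and, for all $1\le m,m'\le M$, $$\mathbf{B}(m)\mathbf{B}(m')=\begin{cases}\mathbf{0} & \text{if } m\ne m',\\ \Big(\prod_{l=1}^d\big(1-\gamma_l(m)^2\big)\Big)\mathbf{B}(m) & \text{if } m'=m.\end{cases}$$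
   Context: Let $\mathcal{G}=(V,E,\mathbf{W})$ be a finite, simple, undirected graph with $N\ge 2$ vertices. A graph signal is a vector in $\mathbb{R}^V$; $\langle\cdot,\cdot\rangle$ is the standard inner product on $\mathbb{R}^V$. A graph shift is a matrix $\mathbf{S}=[s(i,j)]_{i,j\in V}$ with $s(i,j)=0$ unless $i=j$ or $(i,j)\in E$. Standing assumption: $\mathbf{S}_1,\ldots,\mathbf{S}_d$ are graph shifts that are real-valued, symmetric and pairwise commuting. Choose an orthogonal matrix $\mathbf{U}=[\mathbf{u}_1,\ldots,\mathbf{u}_N]$ with $\mathbf{S}_l=\sum_{n=1}^N\lambda_l(n)\mathbf{u}_n\mathbf{u}_n^T$ for $1\le l\le d$, and set $\boldsymbol{\lambda}(n)=[\lambda_1(n),\ldots,\lambda_d(n)]^T\in\mathbb{R}^d$. Let $\boldsymbol{\gamma}(m)=[\gamma_1(m),\ldots,\gamma_d(m)]^T$, $1\le m\le M$, be the distinct elements of $\{\boldsymbol{\lambda}(n): 1\le n\le N\}$. Put $\mathbf{P}_m=\sum_{\boldsymbol{\lambda}(n)=\boldsymbol{\gamma}(m)}\mathbf{u}_n\mathbf{u}_n^T$ (independent of the choice of $\mathbf{U}$) and $\widehat{\mathbf{x}}(m)=\mathbf{P}_m\mathbf{x}$ for $\mathbf{x}\in\mathbb{R}^V$. For $\boldsymbol{\alpha}=(\alpha_1,\ldots,\alpha_d)\in\mathbb{Z}_+^d$ (nonnegative integers) write $\mathbf{S}^{\boldsymbol{\alpha}}=\mathbf{S}_1^{\alpha_1}\cdots\mathbf{S}_d^{\alpha_d}$.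 For a family $\Phi$ of graph signals, $\mathcal{S}(\Phi)=\mathrm{span}\{\mathbf{S}^{\boldsymbol{\alpha}}\phi : \boldsymbol{\alpha}\in\mathbb{Z}_+^d,\ \phi\in\Phi\}$. A family $\tilde\Phi=\{\tilde\phi_1,\ldots,\tilde\phi_r\}\subset\mathcal{S}(\Phi)$ is said to generate a shift-invariant dual frame (for $\mathcal{S}(\Phi)$) if $\mathbf{x}=\sum_{i=1}^r\sum_{\boldsymbol{\alpha}\in\mathbb{Z}_+^d}\langle\mathbf{x},\mathbf{S}^{\boldsymbol{\alpha}}\tilde\phi_i\rangle\,\mathbf{S}^{\boldsymbol{\alpha}}\phi_i$ for all $\mathbf{x}\in\mathcal{S}(\Phi)$. *)

theory Defs
  imports "HOL-Analysis.Analysis"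
begin

text \<open>
  The vertex set is the finite type \<open>'v\<close>, so graph signals live in \<open>real^'v\<close>. A simple
  undirected graph is given by its symmetric irreflexive adjacency relation; the edge weights do
  not enter into the notion of a graph shift.
\<close>

definition simple_graph :: "('v \<times> 'v) set \<Rightarrow> bool" where
  "simple_graph E \<longleftrightarrow> sym E \<and> irrefl E"

definition graph_shift :: "('v::finite \<times> 'v) set \<Rightarrow> real^'v^'v \<Rightarrow> bool" where
  "graph_shift E A \<longleftrightarrow> (\<forall>i j. \<not> (i = j \<or> (i, j) \<in> E) \<longrightarrow> A $ i $ j = 0)"

definition mat_power :: "real^'v^'v \<Rightarrow> nat \<Rightarrow> real^'v^'v::finite" where
  "mat_power A k = (((**) A) ^^ k) (mat 1)"

text \<open>
  A family of \<open>d\<close> shifts is indexed by a finite linearly ordered type \<open>'d\<close>; the linear order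
  fixes the order of the factors in the product \<open>S\<^sub>1\<^bsup>\<alpha>\<^sub>1\<^esup> \<dots> S\<^sub>d\<^bsup>\<alpha>\<^sub>d\<^esup>\<close>, since matrices
  of type \<open>real^'v^'v\<close> do not form a (commutative) monoid type class under \<open>**\<close>. A multi-index
  is a function \<open>'d \<Rightarrow> nat\<close>.
\<close>

definition shift_power ::
    "('d::{finite,linorder} \<Rightarrow> real^'v^'v) \<Rightarrow> ('d \<Rightarrow> nat) \<Rightarrow> real^'v^'v::finite" where
  "shift_power S \<alpha> =
     foldr (\<lambda>l A. mat_power (S l) (\<alpha> l) ** A) (sorted_list_of_set UNIV) (mat 1)"

definition shift_span ::
    "('d::{finite,linorder} \<Rightarrow> real^'v^'v) \<Rightarrow> (real^'v) set \<Rightarrow> (real^'v::finite) set" where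
  "shift_span S \<Phi> = span {shift_power S \<alpha> *v f | \<alpha> f. f \<in> \<Phi>}"

text \<open>
  \<open>infsum\<close> is \<open>0\<close> on non-summable families, so convergence of the inner series is required
  explicitly.
\<close>

definition generates_dual_frame ::
    "('d::{finite,linorder} \<Rightarrow> real^'v^'v) \<Rightarrow> ('r::finite \<Rightarrow> real^'v) \<Rightarrow> ('r \<Rightarrow> real^'v::finite) \<Rightarrow> bool"
  where
  "generates_dual_frame S \<phi> \<psi> \<longleftrightarrow>
     range \<psi> \<subseteq> shift_span S (range \<phi>) \<and>
     (\<forall>x \<in> shift_span S (range \<phi>).
        (\<forall>i. (\<lambda>\<alpha>. (x \<bullet> (shift_power S \<alpha> *v \<psi> i)) *\<^sub>R (shift_power S \<alpha> *v \<phi> i)) summable_on UNIV) \<and>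
        x = (\<Sum>i\<in>UNIV. \<Sum>\<^sub>\<infinity>\<alpha>\<in>UNIV.
               (x \<bullet> (shift_power S \<alpha> *v \<psi> i)) *\<^sub>R (shift_power S \<alpha> *v \<phi> i)))"

definition outer_square :: "real^'v \<Rightarrow> real^'v^'v::finite" where
  "outer_square u = (\<chi> i j. u $ i * u $ j)"

text \<open>
  The \<open>N\<close> columns of the orthogonal matrix \<open>U\<close> are indexed by the vertex type itself, so that
  \<open>U\<close> is a square matrix in the sense of the library.
\<close>

definition joint_diagonalization ::
    "('d::finite \<Rightarrow> real^'v^'v) \<Rightarrow> real^'v^'v::finite \<Rightarrow> ('v \<Rightarrow> real^'d) \<Rightarrow> bool" where
  "joint_diagonalization S U lam \<longleftrightarrow>
     orthogonal_matrix U \<and>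
     (\<forall>l. S l = (\<Sum>n\<in>UNIV. (lam n $ l) *\<^sub>R outer_square (column n U)))"

definition spectral_proj ::
    "real^'v^'v::finite \<Rightarrow> ('v \<Rightarrow> real^'d::finite) \<Rightarrow> real^'d \<Rightarrow> real^'v^'v" where
  "spectral_proj U lam g = (\<Sum>n | lam n = g. outer_square (column n U))"

definition cross_gramian ::
    "real^'v^'v \<Rightarrow> ('r \<Rightarrow> real^'v) \<Rightarrow> ('r \<Rightarrow> real^'v::finite) \<Rightarrow> real^'r^'r::finite" where
  "cross_gramian P \<phi> \<psi> = (\<chi> i j. (P *v \<phi> i) \<bullet> (P *v \<psi> j))"

end

theory Submission
  imports Defs
begin

text \<open>
  The projections \<open>P\<^sub>m\<close> diagonalize all powers \<open>S\<^sup>\<alpha>\<close>, and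
  \<open>\<Sum>\<^sub>\<alpha> \<gamma>(m)\<^sup>\<alpha> \<gamma>(m')\<^sup>\<alpha> = c(m, m')\<close> with \<open>c(m, m') = \<Prod>\<^sub>l 1 / (1 - \<gamma>\<^sub>l(m) \<gamma>\<^sub>l(m'))\<close>. Hence the frame
  operator of the two families is
  \<open>x \<mapsto> \<Sum>\<^sub>m \<Sum>\<^sub>m' c(m, m') \<Sum>\<^sub>i \<langle>x, P\<^sub>m \<psi>\<^sub>i\<rangle> P\<^sub>m' \<phi>\<^sub>i\<close>. By interpolation on the joint spectrum the space
  \<open>S(\<Phi>)\<close> is spanned by the vectors \<open>P\<^sub>m \<phi>\<^sub>k\<close>, so reproducing \<open>S(\<Phi>)\<close> means
  \<open>\<Sum>\<^sub>i \<langle>P\<^sub>m \<phi>\<^sub>k, P\<^sub>m \<psi>\<^sub>i\<rangle> P\<^sub>m' \<phi>\<^sub>i = \<delta>\<^sub>m\<^sub>m' c(m, m)\<^sup>-\<^sup>1 P\<^sub>m \<phi>\<^sub>k\<close> for all \<open>m\<close>, \<open>m'\<close>, \<open>k\<close>. Taking inner products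
  with \<open>P\<^sub>m' \<psi>\<^sub>j\<close> turns this into the equations for \<open>B(m) B(m')\<close>, and nothing is lost if
  \<open>S(\<Psi>) = S(\<Phi>)\<close>.
\<close>

section \<open>Multivariate geometric series and linear algebra\<close>

text \<open>Each one-variable series converges absolutely, so their product may be multiplied out
  over all multi-indices.\<close>

lemma has_sum_multi_geometric:
  fixes z :: "'d::finite \<Rightarrow> real"
  assumes "\<And>l. \<bar>z l\<bar> < 1"
  shows "((\<lambda>\<alpha>. \<Prod>l\<in>UNIV. z l ^ \<alpha> l) has_sum (\<Prod>l\<in>UNIV. 1 / (1 - z l))) UNIV"
proof -
  have abs: "(\<lambda>n. norm (z l ^ n)) summable_on UNIV" for l
    using assms[of l]
    by (intro summable_on_UNIV_nonneg_real_iff[THEN iffD2])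
      (auto simp: power_abs)
  have one: "(\<Sum>\<^sub>\<infinity>n. z l ^ n) = 1 / (1 - z l)" for l
    using assms[of l]
    by (intro infsumI norm_summable_imp_has_sum geometric_sums)
      (auto simp: power_abs)
  have "(\<Sum>\<^sub>\<infinity>\<alpha>\<in>PiE UNIV (\<lambda>_. UNIV). \<Prod>l\<in>UNIV. z l ^ \<alpha> l)
      = (\<Prod>l\<in>UNIV. \<Sum>\<^sub>\<infinity>n\<in>UNIV. z l ^ n)"
    by (rule infsum_prod_PiE_abs) (use abs in auto)
  then have val: "(\<Sum>\<^sub>\<infinity>\<alpha>. \<Prod>l\<in>UNIV. z l ^ \<alpha> l) = (\<Prod>l\<in>UNIV. 1 / (1 - z l))"
    by (simp add: one PiE_UNIV_domain)
  have "1 - z l \<noteq> 0" for l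
    using assms[of l] by auto
  then have "(\<Prod>l\<in>UNIV. 1 / (1 - z l)) \<noteq> 0"
    by simp
  \<comment> \<open>A nonzero \<open>infsum\<close> certifies summability.\<close>
  then show ?thesis
    using val infsum_not_exists has_sum_infsum by metis
qed

lemma has_sum_finite_sum:
  fixes f :: "'i \<Rightarrow> 'a \<Rightarrow> 'b::topological_comm_monoid_add"
  assumes "finite I" "\<And>i. i \<in> I \<Longrightarrow> (f i has_sum s i) A"
  shows "((\<lambda>x. \<Sum>i\<in>I. f i x) has_sum (\<Sum>i\<in>I. s i)) A"
  using assms by (induction I rule: finite_induct) (simp_all add: has_sum_add)

lemma sum_matrix_vector_mult: "(\<Sum>i\<in>I. A i) *v x = (\<Sum>i\<in>I. A i *v x)"
  by (induction I rule: infinite_finite_induct) (auto simp: matrix_vector_mult_add_rdistrib)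

lemma matrix_vector_mult_sum: "A *v (\<Sum>i\<in>I. f i) = (\<Sum>i\<in>I. A *v f i)"
  for A :: "real^'n^'m"
  by (rule linear_sum) simp

lemma outer_square_mult: "outer_square u *v x = (u \<bullet> x) *\<^sub>R u"
  by (simp add: vec_eq_iff outer_square_def matrix_vector_mult_def inner_vec_def
      sum_distrib_left mult_ac)

lemma mat_power_Suc_mult: "mat_power A (Suc k) *v x = A *v (mat_power A k *v x)"
  by (simp add: mat_power_def matrix_vector_mul_assoc)

lemma mat_power_0_mult: "mat_power A 0 *v x = x"
  by (simp add: mat_power_def)

text \<open>The component of \<open>x\<close> orthogonal to \<open>span A\<close> lies in
  \<open>span B\<close> as well, hence vanishes.\<close>

lemma span_eqI_no_orthogonal:
  fixes A B :: "'a::euclidean_space set"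
  assumes "span A \<subseteq> span B"
    and "\<And>x. x \<in> span B \<Longrightarrow> (\<And>a. a \<in> span A \<Longrightarrow> x \<bullet> a = 0) \<Longrightarrow> x = 0"
  shows "span A = span B"
proof (rule subset_antisym[OF assms(1)], rule subsetI)
  fix x assume x: "x \<in> span B"
  obtain y z where y: "y \<in> span A" and z: "\<And>w. w \<in> span A \<Longrightarrow> orthogonal z w" and xyz: "x = y + z"
    using orthogonal_subspace_decomp_exists by metis
  have "z = x - y"
    using xyz by simp
  then have "z \<in> span B"
    using x y assms(1) by (auto intro: span_diff)
  then have "z = 0"
    using assms(2) z by (auto simp: orthogonal_def)
  then show "x \<in> span A"
    using xyz y by simp
qed

section \<open>The frame operator in closed form\<close>

text \<open>The constant c(m, m'): the sum of g^alpha h^alpha over all multi-indices alpha, provided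
  every |g_l h_l| < 1.\<close>

definition multi_geom :: "real^'d \<Rightarrow> real^'d::finite \<Rightarrow> real" where
  "multi_geom g h = (\<Prod>l\<in>UNIV. 1 / (1 - g $ l * h $ l))"

text \<open>A finite sum in place of the series, so that linearity involves no question of
  convergence.\<close>

definition frame_operator ::
    "(real^'d::finite) set \<Rightarrow> (real^'d \<Rightarrow> real^'v^'v) \<Rightarrow> ('r::finite \<Rightarrow> real^'v) \<Rightarrow>
      ('r \<Rightarrow> real^'v) \<Rightarrow> real^'v \<Rightarrow> real^'v::finite" where
  "frame_operator G P \<phi> \<psi> x =
     (\<Sum>g\<in>G. \<Sum>h\<in>G. multi_geom g h *\<^sub>R (\<Sum>i\<in>UNIV. (x \<bullet> (P g *v \<psi> i)) *\<^sub>R (P h *v \<phi> i)))"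

lemma linear_frame_operator: "linear (frame_operator G P \<phi> \<psi>)"
  by (rule linearI)
    (simp_all add: frame_operator_def inner_add_left scaleR_add_left scaleR_add_right
      sum.distrib scaleR_sum_right mult_ac)

section \<open>Spectral resolution and shift-invariant spaces\<close>

text \<open>Isolates the properties of the spectral projections on which the argument rests, indexed
  by the joint eigenvalues themselves and without reference to eigenvectors.\<close>

locale joint_spectral_resolution =
  fixes S :: "'d::{finite,linorder} \<Rightarrow> real^'v^'v::finite"
    and G :: "(real^'d::{finite,linorder}) set"
    and P :: "real^'d::{finite,linorder} \<Rightarrow> real^'v^'v"
  assumes finite_G: "finite G"
    and resolution: "(\<Sum>g\<in>G. P g *v x) = x"
    and P_P: "g \<in> G \<Longrightarrow> h \<in> G \<Longrightarrow> P g *v (P h *v x) = (if g = h then P h *v x else 0)"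
    and P_sym: "g \<in> G \<Longrightarrow> (P g *v x) \<bullet> y = x \<bullet> (P g *v y)"
    and S_P: "g \<in> G \<Longrightarrow> S l *v (P g *v x) = (g $ l) *\<^sub>R (P g *v x)"
begin

lemma P_orthogonal:
  assumes "g \<in> G" "h \<in> G"
  shows "(P g *v x) \<bullet> (P h *v y) = (if g = h then (P g *v x) \<bullet> y else 0)"
  using P_sym[OF assms(2), of "P g *v x" y] P_P[OF assms(2,1), of x] by auto

lemma mat_power_P:
  assumes "g \<in> G"
  shows "mat_power (S l) k *v (P g *v x) = (g $ l) ^ k *\<^sub>R (P g *v x)"
  by (induction k)
    (simp_all add: mat_power_0_mult mat_power_Suc_mult S_P[OF assms] matrix_vector_mult_scaleR mult_ac)

lemma shift_power_P:
  assumes "g \<in> G"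
  shows "shift_power S \<alpha> *v (P g *v x) = (\<Prod>l\<in>UNIV. (g $ l) ^ \<alpha> l) *\<^sub>R (P g *v x)"
proof -
  have "foldr (\<lambda>l A. mat_power (S l) (\<alpha> l) ** A) ls (mat 1) *v (P g *v x)
      = prod_list (map (\<lambda>l. (g $ l) ^ \<alpha> l) ls) *\<^sub>R (P g *v x)" for ls
    by (induction ls)
      (simp_all add: matrix_vector_mul_assoc[symmetric] mat_power_P[OF assms]
        matrix_vector_mult_scaleR mult_ac)
  from this[of "sorted_list_of_set UNIV"] show ?thesis
    by (simp add: shift_power_def prod.distinct_set_conv_list[symmetric])
qed

lemma shift_power_expand:
  "shift_power S \<alpha> *v x = (\<Sum>g\<in>G. (\<Prod>l\<in>UNIV. (g $ l) ^ \<alpha> l) *\<^sub>R (P g *v x))"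
proof -
  have "shift_power S \<alpha> *v x = shift_power S \<alpha> *v (\<Sum>g\<in>G. P g *v x)"
    by (simp add: resolution)
  then show ?thesis
    by (simp add: matrix_vector_mult_sum shift_power_P)
qed

lemma S_expand: "S l *v x = (\<Sum>g\<in>G. (g $ l) *\<^sub>R (P g *v x))"
proof -
  have "S l *v x = S l *v (\<Sum>g\<in>G. P g *v x)"
    by (simp add: resolution)
  then show ?thesis
    by (simp add: matrix_vector_mult_sum S_P)
qed

lemma P_S:
  assumes "g \<in> G"
  shows "P g *v (S l *v x) = (g $ l) *\<^sub>R (P g *v x)"
  using assms finite_G
  by (simp add: S_expand matrix_vector_mult_sum matrix_vector_mult_scaleR P_P if_distrib
      sum.If_cases cong: if_cong)

text \<open>On each joint eigenspace the shifts act as scalars, so the extra factor is absorbed at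
  position \<open>l\<close> despite the fixed order of the product.\<close>

lemma S_shift_power:
  "S l *v (shift_power S \<alpha> *v x) = shift_power S (\<alpha>(l := Suc (\<alpha> l))) *v x"
proof -
  have "(\<Prod>k\<in>UNIV. (g $ k) ^ (\<alpha>(l := Suc (\<alpha> l))) k) = (\<Prod>k\<in>UNIV. (g $ k) ^ \<alpha> k) * g $ l" for g :: "real^'d::{finite,linorder}"
    by (simp add: prod.remove[of UNIV l] mult_ac)
  then show ?thesis
    by (simp add: shift_power_expand matrix_vector_mult_sum matrix_vector_mult_scaleR S_P)
qed

lemma S_shift_span:
  assumes "x \<in> shift_span S F"
  shows "S l *v x \<in> shift_span S F"
  using assms unfolding shift_span_def
proof (induction rule: span_induct_alt)
  case base
  then show ?case by (simp add: span_zero)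
next
  case (step c y z)
  then obtain \<alpha> f where "y = shift_power S \<alpha> *v f" "f \<in> F"
    by auto
  then have "S l *v y \<in> span {shift_power S \<alpha> *v f | \<alpha> f. f \<in> F}"
    by (auto simp: S_shift_power intro!: span_base)
  then show ?case
    using step by (simp add: matrix_vector_right_distrib matrix_vector_mult_scaleR span_add span_mul)
qed

lemma subset_shift_span: "F \<subseteq> shift_span S F"
proof
  fix f assume "f \<in> F"
  moreover have "f = shift_power S (\<lambda>_. 0) *v f"
    by (simp add: shift_power_expand resolution)
  ultimately show "f \<in> shift_span S F"
    unfolding shift_span_def by (blast intro: span_base)
qed

text \<open>
  Lagrange interpolation: \<open>P g\<close> is a product of factors
  \<open>(S\<^sub>l - h\<^sub>l) / (g\<^sub>l - h\<^sub>l)\<close>, one for each \<open>h \<noteq> g\<close>, with \<open>l\<close> depending on \<open>h\<close>.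
\<close>

lemma P_shift_span:
  assumes x: "x \<in> shift_span S F" and g: "g \<in> G"
  shows "P g *v x \<in> shift_span S F"
proof -
  \<comment> \<open>The factors are applied one at a time: \<open>H\<close> collects the points
    already annihilated, while the component at \<open>g\<close> stays that of
    \<open>x\<close>.\<close>
  have "\<exists>y\<in>shift_span S F. P g *v y = P g *v x \<and> (\<forall>h\<in>H. P h *v y = 0)"
    if "finite H" "H \<subseteq> G - {g}" for H
    using that
  proof (induction H rule: finite_induct)
    case empty
    then show ?case using x by auto
  next
    case (insert h H)
    then obtain y where y: "y \<in> shift_span S F" "P g *v y = P g *v x" "\<And>k. k \<in> H \<Longrightarrow> P k *v y = 0"
      by auto
    have "h \<in> G" "h \<noteq> g"
      using insert by auto
    then obtain l where l: "g $ l \<noteq> h $ l"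
      by (metis vec_eq_iff)
    define y' where "y' = (1 / (g $ l - h $ l)) *\<^sub>R (S l *v y - (h $ l) *\<^sub>R y)"
    have P_y': "P k *v y' = ((k $ l - h $ l) / (g $ l - h $ l)) *\<^sub>R (P k *v y)" if "k \<in> G" for k
      using that
      by (simp add: y'_def matrix_vector_mult_scaleR matrix_vector_mult_diff_distrib P_S
          scaleR_diff_left[symmetric])
    have "y' \<in> shift_span S F"
      using S_shift_span[OF y(1), of l] y(1)
      by (simp add: y'_def shift_span_def span_diff span_mul)
    moreover have "P g *v y' = P g *v x"
      using P_y'[OF g] l y(2) by simp
    moreover have "P k *v y' = 0" if "k \<in> insert h H" for k
      using that P_y'[of k] y(3) insert.prems by auto
    ultimately show ?case by blast
  qed
  from this[of "G - {g}"] obtain y where y: "y \<in> shift_span S F" "P g *v y = P g *v x"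
    "\<And>h. h \<in> G - {g} \<Longrightarrow> P h *v y = 0"
    using finite_G by blast
  have "y = (\<Sum>h\<in>G. P h *v y)"
    by (simp add: resolution)
  also have "\<dots> = P g *v x"
    using finite_G g y by (simp add: sum.remove[of G g])
  finally show ?thesis
    using y(1) by simp
qed

lemma P_mem_shift_span: "f \<in> F \<Longrightarrow> g \<in> G \<Longrightarrow> P g *v f \<in> shift_span S F"
  by (intro P_shift_span subsetD[OF subset_shift_span])

text \<open>One inclusion is the spectral expansion of the shift powers, the other is interpolation.
  Multi-indices thereby disappear from the generators.\<close>

lemma shift_span_eq: "shift_span S F = span {P g *v f | g f. g \<in> G \<and> f \<in> F}"
proof (rule subset_antisym)
  have "shift_power S \<alpha> *v f \<in> span {P g *v f | g f. g \<in> G \<and> f \<in> F}" if "f \<in> F" for \<alpha> f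
    unfolding shift_power_expand using that by (intro span_sum span_mul span_base) blast
  then show "shift_span S F \<subseteq> span {P g *v f | g f. g \<in> G \<and> f \<in> F}"
    unfolding shift_span_def by (intro span_minimal) auto
  show "span {P g *v f | g f. g \<in> G \<and> f \<in> F} \<subseteq> shift_span S F"
    by (intro span_minimal) (auto simp: P_mem_shift_span, simp add: shift_span_def)
qed

section \<open>The frame series and its reproducing property\<close>

text \<open>Expanding both shift powers spectrally leaves finitely many geometric series, one for
  each pair of joint eigenvalues.\<close>

lemma has_sum_frame_series:
  assumes lt1: "\<And>g l. g \<in> G \<Longrightarrow> \<bar>g $ l\<bar> < 1"
  shows "((\<lambda>\<alpha>. (x \<bullet> (shift_power S \<alpha> *v q)) *\<^sub>R (shift_power S \<alpha> *v p)) has_sum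
     (\<Sum>g\<in>G. \<Sum>h\<in>G. multi_geom g h *\<^sub>R ((x \<bullet> (P g *v q)) *\<^sub>R (P h *v p)))) UNIV"
proof -
  have "\<bar>g $ l * h $ l\<bar> < 1" if "g \<in> G" "h \<in> G" for g h l
    using lt1[OF that(1), of l] lt1[OF that(2), of l]
    by (metis abs_mult abs_ge_zero mult_strict_mono' mult_1)
  then have "((\<lambda>\<alpha>. (\<Prod>l\<in>UNIV. (g $ l * h $ l) ^ \<alpha> l) *\<^sub>R ((x \<bullet> (P g *v q)) *\<^sub>R (P h *v p)))
      has_sum multi_geom g h *\<^sub>R ((x \<bullet> (P g *v q)) *\<^sub>R (P h *v p))) UNIV"
    if "g \<in> G" "h \<in> G" for g h
    unfolding multi_geom_def using that
    by (intro has_sum_bounded_linear[OF bounded_linear_scaleR_left, unfolded o_def]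
        has_sum_multi_geometric) auto
  then have "((\<lambda>\<alpha>. \<Sum>g\<in>G. \<Sum>h\<in>G. (\<Prod>l\<in>UNIV. (g $ l * h $ l) ^ \<alpha> l) *\<^sub>R
        ((x \<bullet> (P g *v q)) *\<^sub>R (P h *v p)))
      has_sum (\<Sum>g\<in>G. \<Sum>h\<in>G. multi_geom g h *\<^sub>R ((x \<bullet> (P g *v q)) *\<^sub>R (P h *v p)))) UNIV"
    by (intro has_sum_finite_sum finite_G)
  moreover have "(x \<bullet> (shift_power S \<alpha> *v q)) *\<^sub>R (shift_power S \<alpha> *v p)
      = (\<Sum>g\<in>G. \<Sum>h\<in>G. (\<Prod>l\<in>UNIV. (g $ l * h $ l) ^ \<alpha> l) *\<^sub>R
        ((x \<bullet> (P g *v q)) *\<^sub>R (P h *v p)))" for \<alpha>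
    \<comment> \<open>Distributing over the scalar factor first makes the sum over \<open>g\<close>
      the outer one.\<close>
    unfolding shift_power_expand inner_sum_right scaleR_sum_left
    unfolding scaleR_sum_right
    by (simp add: power_mult_distrib prod.distrib mult_ac)
  ultimately show ?thesis by simp
qed

lemma generates_dual_frame_iff_frame_operator:
  assumes "\<And>g l. g \<in> G \<Longrightarrow> \<bar>g $ l\<bar> < 1"
    and "range \<psi> \<subseteq> shift_span S (range \<phi>)"
  shows "generates_dual_frame S \<phi> \<psi> \<longleftrightarrow>
    (\<forall>x\<in>shift_span S (range \<phi>). frame_operator G P \<phi> \<psi> x = x)"
proof -
  note series = has_sum_frame_series[OF assms(1)]
  have "(\<Sum>i\<in>UNIV. \<Sum>\<^sub>\<infinity>\<alpha>. (x \<bullet> (shift_power S \<alpha> *v \<psi> i)) *\<^sub>R (shift_power S \<alpha> *v \<phi> i))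
      = frame_operator G P \<phi> \<psi> x" for x
    by (simp only: infsumI[OF series] frame_operator_def scaleR_sum_right sum.swap[of _ G UNIV])
  then show ?thesis
    using assms(2) has_sum_imp_summable[OF series]
    unfolding generates_dual_frame_def by auto
qed

text \<open>A vector in the range of \<open>P g\<close> is orthogonal to the ranges of the other
  projections, so only the outer term at \<open>g\<close> survives.\<close>

lemma frame_operator_P:
  assumes "g \<in> G"
  shows "frame_operator G P \<phi> \<psi> (P g *v y) =
    (\<Sum>h\<in>G. multi_geom g h *\<^sub>R (\<Sum>i\<in>UNIV. ((P g *v y) \<bullet> (P g *v \<psi> i)) *\<^sub>R (P h *v \<phi> i)))"
proof -
  have "(\<Sum>h\<in>G. multi_geom g' h *\<^sub>R (\<Sum>i\<in>UNIV. ((P g *v y) \<bullet> (P g' *v \<psi> i)) *\<^sub>R (P h *v \<phi> i))) = 0"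
    if "g' \<in> G - {g}" for g'
    using that assms P_orthogonal[of g g'] by (auto intro: sum.neutral)
  then show ?thesis
    unfolding frame_operator_def using assms finite_G by (subst sum.remove[of G g]) auto
qed

text \<open>By linearity it suffices to test the generators \<open>P g *v \<phi> k\<close>; the
  resulting identity splits into its components in the ranges of the \<open>P h\<close>.\<close>

lemma frame_operator_id_iff:
  assumes lt1: "\<And>g l. g \<in> G \<Longrightarrow> \<bar>g $ l\<bar> < 1"
  shows "(\<forall>x\<in>shift_span S (range \<phi>). frame_operator G P \<phi> \<psi> x = x) \<longleftrightarrow>
    (\<forall>g\<in>G. \<forall>h\<in>G. \<forall>k. (\<Sum>i\<in>UNIV. ((P g *v \<phi> k) \<bullet> (P g *v \<psi> i)) *\<^sub>R (P h *v \<phi> i)) =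
      (if g = h then (\<Prod>l\<in>UNIV. 1 - (g $ l)\<^sup>2) *\<^sub>R (P g *v \<phi> k) else 0))"
    (is "?L \<longleftrightarrow> (\<forall>g\<in>G. \<forall>h\<in>G. \<forall>k. ?s g h k = ?t g h k)")
proof -
  have "1 - g $ l * h $ l \<noteq> 0" if "g \<in> G" "h \<in> G" for g h l
    using lt1[OF that(1), of l] lt1[OF that(2), of l]
      mult_strict_mono'[of "\<bar>g $ l\<bar>" 1 "\<bar>h $ l\<bar>" 1]
    by (auto simp: abs_mult[symmetric])
  then have nz: "multi_geom g h \<noteq> 0" if "g \<in> G" "h \<in> G" for g h
    using that by (simp add: multi_geom_def)
  \<comment> \<open>On the diagonal \<open>multi_geom\<close> is the reciprocal of the factor in
    \<open>?t\<close>.\<close>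
  have diag: "multi_geom g g * (\<Prod>l\<in>UNIV. 1 - (g $ l)\<^sup>2) = 1" if "g \<in> G" for g
    using nz[OF that that] by (simp add: multi_geom_def power2_eq_square prod_dividef)
  have P_s: "P h *v ?s g h' k = (if h = h' then ?s g h' k else 0)" if "h \<in> G" "h' \<in> G" for g h h' k
    using that by (simp add: matrix_vector_mult_sum matrix_vector_mult_scaleR P_P)
  show ?thesis
  proof
    assume L: ?L
    show "\<forall>g\<in>G. \<forall>h\<in>G. \<forall>k. ?s g h k = ?t g h k"
    proof (intro ballI allI)
      fix g h k assume gh: "g \<in> G" "h \<in> G"
      have "P g *v \<phi> k \<in> shift_span S (range \<phi>)"
        using gh by (simp add: P_mem_shift_span)
      then have "(\<Sum>h\<in>G. multi_geom g h *\<^sub>R ?s g h k) = P g *v \<phi> k"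
        unfolding frame_operator_P[OF gh(1), symmetric] using L by blast
      \<comment> \<open>Applying \<open>P h\<close> isolates the single summand at \<open>h\<close>,
        because \<open>?s g h' k\<close> lies in the range of \<open>P h'\<close>.\<close>
      then have "P h *v (\<Sum>h\<in>G. multi_geom g h *\<^sub>R ?s g h k) = P h *v (P g *v \<phi> k)"
        by simp
      moreover have "P h *v (\<Sum>h\<in>G. multi_geom g h *\<^sub>R ?s g h k)
          = (\<Sum>h'\<in>G. if h = h' then multi_geom g h' *\<^sub>R ?s g h' k else 0)"
        unfolding matrix_vector_mult_sum[of _ _ G] matrix_vector_mult_scaleR
        using gh by (intro sum.cong refl) (simp add: P_s)
      ultimately have eq: "multi_geom g h *\<^sub>R ?s g h k = (if g = h then P g *v \<phi> k else 0)"
        using gh finite_G P_P[of h g "\<phi> k"] by (auto split: if_splits)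
      show "?s g h k = ?t g h k"
      proof (cases "g = h")
        case True
        have "?s g h k = (\<Prod>l\<in>UNIV. 1 - (g $ l)\<^sup>2) *\<^sub>R (multi_geom g h *\<^sub>R ?s g h k)"
          using diag[OF gh(1)] True by (simp add: mult.commute)
        then show ?thesis
          unfolding eq using True by simp
      next
        case False
        then show ?thesis
          using eq nz[OF gh] by simp
      qed
    qed
  next
    assume R: "\<forall>g\<in>G. \<forall>h\<in>G. \<forall>k. ?s g h k = ?t g h k"
    have gen: "frame_operator G P \<phi> \<psi> (P g *v \<phi> k) = P g *v \<phi> k" if g: "g \<in> G" for g k
    proof -
      have "frame_operator G P \<phi> \<psi> (P g *v \<phi> k) = (\<Sum>h\<in>G. multi_geom g h *\<^sub>R ?t g h k)"
        unfolding frame_operator_P[OF g] using R g by (intro sum.cong refl) simp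
      also have "\<dots> = (\<Sum>h\<in>G. if g = h then P g *v \<phi> k else 0)"
        using diag g by (intro sum.cong refl) simp
      finally show ?thesis
        using g finite_G by simp
    qed
    have "frame_operator G P \<phi> \<psi> x = id x" if "x \<in> shift_span S (range \<phi>)" for x
      by (rule linear_eq_on_span[OF linear_frame_operator linear_id _ that[unfolded shift_span_eq]])
        (auto simp: gen)
    then show ?L by simp
  qed
qed

section \<open>Gramian equations and equality of the spans\<close>

text \<open>Orthogonality to \<open>P g *v \<psi> j\<close> for \<open>g\<close> other than
  \<open>h\<close> is automatic. Thus \<open>x\<close> is orthogonal to a spanning set of a space
  that contains it, hence to itself.\<close>

lemma eq_0_if_orthogonal:
  assumes x: "x \<in> shift_span S (range \<psi>)" and h: "h \<in> G" and Px: "P h *v x = x"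
    and orth: "\<And>j. x \<bullet> (P h *v \<psi> j) = 0"
  shows "x = 0"
proof -
  have "x \<bullet> (P g *v \<psi> j) = 0" if "g \<in> G" for g j
    using orth P_orthogonal[OF h that, of x "\<psi> j"] Px by metis
  then have "orthogonal x x"
    by (intro orthogonal_to_span[OF x[unfolded shift_span_eq]]) (auto simp: orthogonal_def)
  then show ?thesis by (simp add: orthogonal_self)
qed

text \<open>The matrix equation is the vector equation tested against the
  \<open>P h *v \<psi> j\<close>. Equality of the spans puts the difference of the two sides where
  these tests detect it.\<close>

lemma cross_gramian_mult_iff:
  fixes \<phi> \<psi> :: "'r::finite \<Rightarrow> real^'v"
  assumes span: "shift_span S (range \<psi>) = shift_span S (range \<phi>)" and g: "g \<in> G" and h: "h \<in> G"
  shows "cross_gramian (P g) \<phi> \<psi> ** cross_gramian (P h) \<phi> \<psi> =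
      (if g = h then c *\<^sub>R cross_gramian (P g) \<phi> \<psi> else 0) \<longleftrightarrow>
    (\<forall>k. (\<Sum>i\<in>UNIV. ((P g *v \<phi> k) \<bullet> (P g *v \<psi> i)) *\<^sub>R (P h *v \<phi> i)) =
      (if g = h then c *\<^sub>R (P g *v \<phi> k) else 0))"
    (is "?L \<longleftrightarrow> (\<forall>k. ?s k = ?t k)")
proof -
  have entries: "A = B \<longleftrightarrow> (\<forall>k j. A $ k $ j = B $ k $ j)" for A B :: "real^'r^'r"
    by (simp add: vec_eq_iff)
  have entry: "?L \<longleftrightarrow> (\<forall>k j. (?s k - ?t k) \<bullet> (P h *v \<psi> j) = 0)"
    by (cases "g = h") (simp_all add: entries matrix_matrix_mult_def
        cross_gramian_def inner_diff_left inner_sum_left)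
  have mem: "P g' *v \<phi> i \<in> shift_span S (range \<psi>)" if "g' \<in> G" for g' i
    unfolding span using that by (simp add: P_mem_shift_span)
  have "?s k - ?t k \<in> shift_span S (range \<psi>)" for k
    using mem[OF g] mem[OF h] unfolding shift_span_def
    by (auto intro!: span_diff span_sum span_mul span_zero)
  moreover have "P h *v (?s k - ?t k) = ?s k - ?t k" for k
    using g h
    by (auto simp: matrix_vector_mult_diff_distrib matrix_vector_mult_sum matrix_vector_mult_scaleR P_P)
  ultimately have "?s k - ?t k = 0" if "\<forall>j. (?s k - ?t k) \<bullet> (P h *v \<psi> j) = 0" for k
    using eq_0_if_orthogonal[OF _ h] that by blast
  then show ?thesis
    unfolding entry by auto
qed

text \<open>A vector of S(Phi) orthogonal to S(Psi) has only zero coefficients, so the frame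
  operator sends it to 0; being reproduced, it is 0.\<close>

lemma shift_span_eq_if_dual:
  assumes sub: "range \<psi> \<subseteq> shift_span S (range \<phi>)"
    and id: "\<forall>x\<in>shift_span S (range \<phi>). frame_operator G P \<phi> \<psi> x = x"
  shows "shift_span S (range \<psi>) = shift_span S (range \<phi>)"
  unfolding shift_span_eq
proof (rule span_eqI_no_orthogonal)
  show "span {P g *v f |g f. g \<in> G \<and> f \<in> range \<psi>} \<subseteq> span {P g *v f |g f. g \<in> G \<and> f \<in> range \<phi>}"
    using P_shift_span[of _ "range \<phi>"] sub unfolding shift_span_eq
    by (intro span_minimal) auto
next
  fix x
  assume x: "x \<in> span {P g *v f |g f. g \<in> G \<and> f \<in> range \<phi>}"
    and orth: "\<And>a. a \<in> span {P g *v f |g f. g \<in> G \<and> f \<in> range \<psi>} \<Longrightarrow> x \<bullet> a = 0"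
  have "x \<bullet> (P g *v \<psi> i) = 0" if "g \<in> G" for g i
    using that by (intro orth span_base) blast
  then have "frame_operator G P \<phi> \<psi> x = 0"
    by (simp add: frame_operator_def)
  then show "x = 0"
    using id x by (simp add: shift_span_eq)
qed

theorem generates_dual_frame_iff:
  assumes lt1: "\<And>g l. g \<in> G \<Longrightarrow> \<bar>g $ l\<bar> < 1"
    and sub: "range \<psi> \<subseteq> shift_span S (range \<phi>)"
  shows "generates_dual_frame S \<phi> \<psi> \<longleftrightarrow>
    shift_span S (range \<psi>) = shift_span S (range \<phi>) \<and>
    (\<forall>g\<in>G. \<forall>h\<in>G. cross_gramian (P g) \<phi> \<psi> ** cross_gramian (P h) \<phi> \<psi> =
      (if g = h then (\<Prod>l\<in>UNIV. 1 - (g $ l)\<^sup>2) *\<^sub>R cross_gramian (P g) \<phi> \<psi> else 0))"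
proof -
  have dual: "generates_dual_frame S \<phi> \<psi> \<longleftrightarrow>
      (\<forall>x\<in>shift_span S (range \<phi>). frame_operator G P \<phi> \<psi> x = x)"
    using lt1 sub by (rule generates_dual_frame_iff_frame_operator)
  show ?thesis
  \<comment> \<open>If the spans differ, both sides are false; if they agree, the vector and Gramian
    equations are equivalent.\<close>
  proof (cases "shift_span S (range \<psi>) = shift_span S (range \<phi>)")
    case True
    then show ?thesis
      using dual frame_operator_id_iff[where \<phi> = \<phi> and \<psi> = \<psi>, OF lt1]
      by (simp add: cross_gramian_mult_iff cong: ball_cong)
  next
    case False
    then show ?thesis
      using dual shift_span_eq_if_dual[OF sub] by blast
  qed
qed

end

section \<open>Spectral projections of a joint diagonalization\<close>

lemma orthogonal_matrix_columns:
  assumes "orthogonal_matrix (U :: real^'n^'n)"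
  shows "column m U \<bullet> column n U = (if m = n then 1 else 0)"
  using assms by (simp add: orthogonal_matrix_orthonormal_columns norm_eq_1 orthogonal_def)

lemma orthogonal_matrix_expansion:
  assumes "orthogonal_matrix (U :: real^'n^'n)"
  shows "(\<Sum>n\<in>UNIV. (column n U \<bullet> x) *\<^sub>R column n U) = x"
proof -
  have "U *v (transpose U *v x) = x"
    using assms
    by (simp add: matrix_vector_mul_assoc orthogonal_matrix_def del: transpose_matrix_vector)
  then show ?thesis
    by (simp add: matrix_mult_sum[of U] scalar_mult_eq_scaleR matrix_vector_mul_component
        transpose_def column_def del: transpose_matrix_vector)
qed

lemma joint_spectral_resolution_spectral_proj:
  assumes "joint_diagonalization S U lam"
  shows "joint_spectral_resolution S (range lam) (spectral_proj U lam)"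
proof -
  have U: "orthogonal_matrix U" and S: "\<And>l. S l = (\<Sum>n\<in>UNIV. (lam n $ l) *\<^sub>R outer_square (column n U))"
    using assms by (auto simp: joint_diagonalization_def)
  note orth = orthogonal_matrix_columns[OF U]
  have P: "spectral_proj U lam g *v x = (\<Sum>n | lam n = g. (column n U \<bullet> x) *\<^sub>R column n U)" for g x
    by (simp add: spectral_proj_def sum_matrix_vector_mult outer_square_mult)
  \<comment> \<open>In the orthonormal basis of columns the projection keeps the coordinates with
    joint eigenvalue \<open>g\<close> and deletes the rest.\<close>
  have col: "column m U \<bullet> (spectral_proj U lam g *v x) = (if lam m = g then column m U \<bullet> x else 0)"
    for m g x
    by (simp add: P inner_sum_right orth if_distrib cong: if_cong)
  show ?thesis
  proof
    show "(\<Sum>g\<in>range lam. spectral_proj U lam g *v x) = x" for x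
      \<comment> \<open>The basis expansion of \<open>x\<close> is grouped by joint
        eigenvalue.\<close>
      unfolding P using sum.group[of UNIV "range lam" lam "\<lambda>n. (column n U \<bullet> x) *\<^sub>R column n U"]
      by (simp add: orthogonal_matrix_expansion[OF U])
    show "spectral_proj U lam g *v (spectral_proj U lam h *v x)
        = (if g = h then spectral_proj U lam h *v x else 0)" for g h x
      unfolding P[of g] col by (auto simp: P intro!: sum.neutral)
    show "(spectral_proj U lam g *v x) \<bullet> y = x \<bullet> (spectral_proj U lam g *v y)" for g x y
      by (simp add: P inner_sum_left inner_sum_right inner_commute mult.commute)
    show "S l *v (spectral_proj U lam g *v x) = (g $ l) *\<^sub>R (spectral_proj U lam g *v x)" for l g x
    proof -
      have "S l *v (spectral_proj U lam g *v x)
          = (\<Sum>n\<in>UNIV. if lam n = g then (g $ l * (column n U \<bullet> x)) *\<^sub>R column n U else 0)"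
        unfolding S sum_matrix_vector_mult scaleR_matrix_vector_assoc[symmetric] outer_square_mult col
        by (intro sum.cong) auto
      then show ?thesis
        by (simp add: P scaleR_sum_right sum.If_cases)
    qed
  qed simp
qed

theorem theorem4p9:
  fixes E :: "('v::finite \<times> 'v) set"
    and S :: "'d::{finite,linorder} \<Rightarrow> real^'v^'v"
    and U :: "real^'v^'v"
    and lam :: "'v \<Rightarrow> real^'d::{finite,linorder}"
    and \<gamma> :: "nat \<Rightarrow> real^'d::{finite,linorder}"
    and M :: nat
    and \<phi> \<psi> :: "'r::finite \<Rightarrow> real^'v"
    and B :: "nat \<Rightarrow> real^'r^'r"
  assumes "CARD('v) \<ge> 2"
    and "simple_graph E"
    and "\<And>l. graph_shift E (S l)"
    and "\<And>l. transpose (S l) = S l"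
    and "\<And>k l. S k ** S l = S l ** S k"
    and "joint_diagonalization S U lam"
    and "bij_betw \<gamma> {1..M} (range lam)"
    and "\<And>m l. m \<in> {1..M} \<Longrightarrow> \<bar>\<gamma> m $ l\<bar> < 1"
    and "\<And>i. \<phi> i \<noteq> 0"
    and "range \<psi> \<subseteq> shift_span S (range \<phi>)"
    and "\<And>m. m \<in> {1..M} \<Longrightarrow> B m = cross_gramian (spectral_proj U lam (\<gamma> m)) \<phi> \<psi>"
  shows "generates_dual_frame S \<phi> \<psi> \<longleftrightarrow>
    shift_span S (range \<psi>) = shift_span S (range \<phi>) \<and>
    (\<forall>m\<in>{1..M}. \<forall>m'\<in>{1..M}.
       B m ** B m' = (if m \<noteq> m' then 0 else (\<Prod>l\<in>UNIV. 1 - (\<gamma> m $ l)\<^sup>2) *\<^sub>R B m))"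
proof -
  interpret joint_spectral_resolution S "range lam" "spectral_proj U lam"
    by (rule joint_spectral_resolution_spectral_proj) fact
  have img: "range lam = \<gamma> ` {1..M}" and inj: "inj_on \<gamma> {1..M}"
    using assms(7) by (auto simp: bij_betw_def)
  have lt1: "\<bar>g $ l\<bar> < 1" if "g \<in> range lam" for g l
    using that assms(8) unfolding img by auto
  \<comment> \<open>Reindexing along \<open>\<gamma>\<close>; injectivity turns equality of joint
    eigenvalues into equality of indices.\<close>
  have "(\<forall>g\<in>range lam. \<forall>h\<in>range lam.
      cross_gramian (spectral_proj U lam g) \<phi> \<psi> ** cross_gramian (spectral_proj U lam h) \<phi> \<psi> =
      (if g = h then (\<Prod>l\<in>UNIV. 1 - (g $ l)\<^sup>2) *\<^sub>R cross_gramian (spectral_proj U lam g) \<phi> \<psi> else 0))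
    \<longleftrightarrow> (\<forall>m\<in>{1..M}. \<forall>m'\<in>{1..M}.
       B m ** B m' = (if m \<noteq> m' then 0 else (\<Prod>l\<in>UNIV. 1 - (\<gamma> m $ l)\<^sup>2) *\<^sub>R B m))"
    unfolding img ball_simps using assms(11) inj_onD[OF inj]
    by (intro ball_cong refl) auto
  then show ?thesis
    using generates_dual_frame_iff[OF lt1 assms(10)] by simp
qed

end
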